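(* Let $N\ge 2$, let $\boldsymbol{x}^*(\alpha)\in\mathbb{R}^N$ be a deterministic vector, and let the observed snapshot be $\boldsymbol{x}=\boldsymbol{x}^*(\alpha)+\boldsymbol{z}$, where $\boldsymbol{z}$ is a random vector with distribution $\mathcal{N}(\boldsymbol{0},C(\alpha))$, $C(\alpha)\in\mathbb{R}^{N\times N}$. Let $V=\operatorname{Var}(\boldsymbol{x})$ be the spatial variance of the snapshot. Then $$\mathbb{E}[V]=\underbrace{\operatorname{Var}\big(\boldsymbol{x}^*(\alpha)\big)}_{S(\alpha)}+\underbrace{\frac{1}{N-1}\operatorname{Tr}\big(P\,C(\alpha)\big)}_{\Phi(\alpha)},$$ where $P=I-\tfrac1N\boldsymbol{1}\boldsymbol{1}^\top$.
   Context: For a vector $\boldsymbol{u}\in\mathbb{R}^N$, $\bar u=N^{-1}\sum_{i=1}^N u_i$ and $\operatorname{Var}(\boldsymbol{u})=\frac{1}{N-1}\sum_{i=1}^N(u_i-\bar u)^2$ is the sample variance across the components (nodes). $\boldsymbol{1}$ is the all-ones vector in $\mathbb{R}^N$. The expectation is over the law of $\boldsymbol{z}$ at fixed $\alpha$. *)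

theory Defs
  imports "HOL-Probability.Probability"
begin

definition component_mean :: "real ^ 'n \<Rightarrow> real" where
  "component_mean u = (\<Sum>i\<in>UNIV. u $ i) / real CARD('n)"

definition component_variance :: "real ^ 'n \<Rightarrow> real" where
  "component_variance u = (\<Sum>i\<in>UNIV. (u $ i - component_mean u)\<^sup>2) / (real CARD('n) - 1)"

definition centering_matrix :: "real ^ 'n ^ 'n" where
  "centering_matrix = mat 1 -
     (1 / real CARD('n)) *\<^sub>R
       ((columnvector (1 :: real ^ 'n) :: real ^ 1 ^ 'n) ** (rowvector (1 :: real ^ 'n) :: real ^ 'n ^ 1))"

(* The second parameter is the variance (not the standard deviation, as in normal_density);
   variance 0 gives the point mass at the mean. *)
definition normal_law :: "real \<Rightarrow> real \<Rightarrow> real measure" where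
  "normal_law m v =
     (if v = 0 then return borel m
      else density lborel (\<lambda>t. ennreal (normal_density m (sqrt v) t)))"

(* D is the law N(m, C): every linear functional of a D-distributed vector is univariate normal
   with the corresponding mean and variance. C may be singular, so D need not have a density
   with respect to lborel. *)
definition multivariate_normal_law ::
    "real ^ 'n \<Rightarrow> real ^ 'n ^ 'n \<Rightarrow> (real ^ 'n) measure \<Rightarrow> bool" where
  "multivariate_normal_law m C D \<longleftrightarrow>
     prob_space D \<and> sets D = sets borel \<and>
     transpose C = C \<and> (\<forall>a. 0 \<le> a \<bullet> (C *v a)) \<and>
     (\<forall>a. distr D borel (\<lambda>u. a \<bullet> u) = normal_law (a \<bullet> m) (a \<bullet> (C *v a)))"

end

theory Submission
  imports Defs
begin

text \<open>Each deviation from the component mean is the linear functional given by a row of the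
  centering matrix \<open>P\<close>, so the Gaussian hypothesis is only used through the first two moments of
  these functionals. The cross terms are centred, and the quadratic terms sum to
  \<open>Tr(P C P\<^sup>T) = Tr(P C)\<close> because \<open>P\<close> is a symmetric idempotent.\<close>

text \<open>The point mass is treated separately because \<open>normal_law\<close> is defined by a
  density only for nonzero variance. For \<open>v > 0\<close> the claims reduce to the known moments
  of \<open>normal_density\<close> with standard deviation \<open>sqrt v\<close>.\<close>

lemma normal_law_moments:
  assumes "v \<ge> 0"
  shows "integrable (normal_law m v) (\<lambda>t. t)" "(\<integral>t. t \<partial>normal_law m v) = m"
    and "integrable (normal_law m v) (\<lambda>t. (t - m)\<^sup>2)" "(\<integral>t. (t - m)\<^sup>2 \<partial>normal_law m v) = v"
proof -
  have "integrable (normal_law m v) (\<lambda>t. t) \<and> (\<integral>t. t \<partial>normal_law m v) = m \<and>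
    integrable (normal_law m v) (\<lambda>t. (t - m)\<^sup>2) \<and> (\<integral>t. (t - m)\<^sup>2 \<partial>normal_law m v) = v"
  proof (cases "v = 0")
    case True
    interpret prob_space "return borel m" by (rule prob_space_return) simp
    \<comment> \<open>Under the point mass at \<open>m\<close>, a measurable \<open>f\<close> equals
      the constant \<open>f m\<close> almost everywhere.\<close>
    have int: "integrable (return borel m) f" if "f \<in> borel_measurable borel" for f :: "real \<Rightarrow> real"
      using that by (subst integrable_cong_AE[where g = "\<lambda>_. f m"]) (auto simp: AE_return)
    have "integrable (return borel m) (\<lambda>t. t)" "integrable (return borel m) (\<lambda>t. (t - m)\<^sup>2)"
      by (rule int, measurable)+
    moreover have "(\<integral>t. t \<partial>return borel m) = m" "(\<integral>t. (t - m)\<^sup>2 \<partial>return borel m) = 0"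
      by (simp_all add: integral_return)
    ultimately show ?thesis
      unfolding True normal_law_def by simp
  next
    case False
    with assms have pos: "sqrt v > 0" by simp
    have density: "integrable (normal_law m v) f \<longleftrightarrow>
          integrable lborel (\<lambda>t. normal_density m (sqrt v) t * f t)"
        "(\<integral>t. f t \<partial>normal_law m v) = (\<integral>t. normal_density m (sqrt v) t * f t \<partial>lborel)"
      if "f \<in> borel_measurable borel" for f :: "real \<Rightarrow> real"
      using that False by (simp_all add: normal_law_def integrable_density integral_density)
    \<comment> \<open>The central moment of order \<open>2 * k\<close> at \<open>k = 1\<close> is
      the squared standard deviation, here \<open>v\<close>.\<close>
    have second_moment: "(\<integral>t. normal_density m (sqrt v) t * (t - m)\<^sup>2 \<partial>lborel) = v"
      using integral_normal_moment_even[OF pos, of m 1] assms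
      by (simp add: has_bochner_integral_integral_eq)
    show ?thesis
      using integrable_normal_moment_nz_1[OF pos, of m] integral_normal_moment_nz_1[OF pos, of m]
        integrable_normal_moment[OF pos, of m 2] second_moment
      by (simp add: density)
  qed
  then show "integrable (normal_law m v) (\<lambda>t. t)" "(\<integral>t. t \<partial>normal_law m v) = m"
    and "integrable (normal_law m v) (\<lambda>t. (t - m)\<^sup>2)" "(\<integral>t. (t - m)\<^sup>2 \<partial>normal_law m v) = v"
    by auto
qed

text \<open>Each integrand depends on \<open>z\<close> only through the scalar
  \<open>a \<bullet> z \<omega>\<close>, whose law is univariate normal, so the integrals over
  \<open>M\<close> become integrals against \<open>normal_law\<close>.\<close>

lemma multivariate_normal_law_moments:
  assumes z: "z \<in> borel_measurable M" and D: "multivariate_normal_law m C (distr M borel z)"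
  shows "integrable M (\<lambda>\<omega>. a \<bullet> z \<omega>)" "(\<integral>\<omega>. a \<bullet> z \<omega> \<partial>M) = a \<bullet> m"
    and "integrable M (\<lambda>\<omega>. (a \<bullet> z \<omega> - a \<bullet> m)\<^sup>2)"
    and "(\<integral>\<omega>. (a \<bullet> z \<omega> - a \<bullet> m)\<^sup>2 \<partial>M) = a \<bullet> (C *v a)"
proof -
  note [measurable] = z
  have nonneg: "0 \<le> a \<bullet> (C *v a)"
    and law: "distr M borel (\<lambda>\<omega>. a \<bullet> z \<omega>) = normal_law (a \<bullet> m) (a \<bullet> (C *v a))"
    using D by (auto simp: multivariate_normal_law_def distr_distr comp_def)
  have transfer: "integrable M (\<lambda>\<omega>. f (a \<bullet> z \<omega>)) \<longleftrightarrow>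
        integrable (normal_law (a \<bullet> m) (a \<bullet> (C *v a))) f"
      "(\<integral>\<omega>. f (a \<bullet> z \<omega>) \<partial>M) = (\<integral>t. f t \<partial>normal_law (a \<bullet> m) (a \<bullet> (C *v a)))"
    if "f \<in> borel_measurable borel" for f :: "real \<Rightarrow> real"
    unfolding law[symmetric] using that by (simp_all add: integrable_distr_eq integral_distr)
  have square_measurable: "(\<lambda>t::real. (t - a \<bullet> m)\<^sup>2) \<in> borel_measurable borel"
    by measurable
  show "integrable M (\<lambda>\<omega>. a \<bullet> z \<omega>)" "(\<integral>\<omega>. a \<bullet> z \<omega> \<partial>M) = a \<bullet> m"
    and "integrable M (\<lambda>\<omega>. (a \<bullet> z \<omega> - a \<bullet> m)\<^sup>2)"
    and "(\<integral>\<omega>. (a \<bullet> z \<omega> - a \<bullet> m)\<^sup>2 \<partial>M) = a \<bullet> (C *v a)"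
    by (simp_all only: transfer[of "\<lambda>t. t"] transfer[of "\<lambda>t. (t - a \<bullet> m)\<^sup>2"]
        measurable_ident_sets[OF refl] square_measurable normal_law_moments[OF nonneg])
qed

lemma centering_matrix_nth:
  "(centering_matrix :: real ^ 'n ^ 'n) $ i $ j = (if i = j then 1 else 0) - 1 / real CARD('n)"
  by (simp add: centering_matrix_def mat_def matrix_matrix_mult_def columnvector_def rowvector_def)

lemma transpose_centering_matrix: "transpose centering_matrix = centering_matrix"
  by (auto simp: vec_eq_iff transpose_def centering_matrix_nth)

text \<open>Row \<open>i\<close> is the \<open>i\<close>-th unit vector minus the constant vector
  with entries \<open>1/N\<close>, where \<open>N = CARD('n)\<close>.\<close>

lemma centering_matrix_row_inner:
  "centering_matrix $ i \<bullet> u = u $ i - component_mean (u :: real ^ 'n)"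
  by (simp add: inner_vec_def centering_matrix_nth component_mean_def left_diff_distrib
      sum_subtractf sum_divide_distrib if_distribR if_distrib[of "\<lambda>c. c * _"] cong: if_cong)

lemma component_variance_centering_matrix:
  "component_variance (u :: real ^ 'n) =
    (\<Sum>i\<in>UNIV. (centering_matrix $ i \<bullet> u)\<^sup>2) / (real CARD('n) - 1)"
  by (simp add: component_variance_def centering_matrix_row_inner)

lemma centering_matrix_idempotent:
  "centering_matrix ** centering_matrix = (centering_matrix :: real ^ 'n ^ 'n)"
proof -
  have "(centering_matrix ** centering_matrix) $ i $ j =
      centering_matrix $ i \<bullet> (centering_matrix $ j :: real ^ 'n)" for i j :: 'n
    \<comment> \<open>Writing the second factor as its own transpose turns its columns into
      rows.\<close>
    by (subst (2) transpose_centering_matrix[symmetric])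
      (simp add: matrix_matrix_mult_def inner_vec_def transpose_def)
  \<comment> \<open>Pairing with row \<open>i\<close> subtracts from row \<open>j\<close> its mean,
    which is zero because the entries of a row sum to \<open>1 - N/N\<close>.\<close>
  also have "\<dots> i j = centering_matrix $ i $ j" for i j :: 'n
    by (simp add: centering_matrix_row_inner component_mean_def centering_matrix_nth sum_subtractf)
  finally show ?thesis by (simp add: vec_eq_iff)
qed

text \<open>The summand for \<open>i\<close> is the \<open>i\<close>-th diagonal entry of the triple
  product.\<close>

lemma sum_row_quadratic_form:
  fixes A :: "real ^ 'n ^ 'm" and C :: "real ^ 'n ^ 'n"
  shows "(\<Sum>i\<in>UNIV. A $ i \<bullet> (C *v A $ i)) = trace (A ** C ** transpose A)"
  unfolding matrix_mul_assoc[symmetric]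
  by (simp add: trace_def matrix_matrix_mult_def matrix_vector_mult_def inner_vec_def transpose_def)

text \<open>By symmetry of \<open>P\<close> the sum is the trace of \<open>P C P\<close>; cyclicity
  of the trace brings both copies of \<open>P\<close> together, and idempotence leaves one.\<close>

lemma trace_centering_matrix:
  "(\<Sum>i\<in>UNIV. centering_matrix $ i \<bullet> (C *v centering_matrix $ i)) =
    trace (centering_matrix ** (C :: real ^ 'n ^ 'n))"
proof -
  have "(\<Sum>i\<in>UNIV. centering_matrix $ i \<bullet> (C *v centering_matrix $ i)) =
      trace (centering_matrix ** (C ** centering_matrix))"
    by (simp only: sum_row_quadratic_form transpose_centering_matrix matrix_mul_assoc)
  also have "\<dots> = trace (C ** (centering_matrix ** centering_matrix))"
    by (subst trace_mul_sym) (simp only: matrix_mul_assoc)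
  also have "\<dots> = trace (centering_matrix ** C)"
    unfolding centering_matrix_idempotent by (rule trace_mul_sym)
  finally show ?thesis .
qed

theorem proposition3p1:
  fixes M :: "'a measure"
    and xstar :: "'p \<Rightarrow> real ^ 'n"
    and C :: "'p \<Rightarrow> real ^ 'n ^ 'n"
    and \<alpha> :: 'p
    and z x :: "'a \<Rightarrow> real ^ 'n"
    and V :: "'a \<Rightarrow> real"
  assumes "CARD('n) \<ge> 2"
    and "prob_space M"
    and "z \<in> borel_measurable M"
    and "multivariate_normal_law 0 (C \<alpha>) (distr M borel z)"
    and "\<And>\<omega>. \<omega> \<in> space M \<Longrightarrow> x \<omega> = xstar \<alpha> + z \<omega>"
    and "\<And>\<omega>. \<omega> \<in> space M \<Longrightarrow> V \<omega> = component_variance (x \<omega>)"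
  shows "integrable M V \<and>
    (\<integral>\<omega>. V \<omega> \<partial>M) =
      component_variance (xstar \<alpha>) +
      1 / (real CARD('n) - 1) * trace (centering_matrix ** C \<alpha>)"
proof -
  interpret prob_space M by fact
  note moments = multivariate_normal_law_moments[OF assms(3,4), simplified]
  let ?p = "\<lambda>i. (centering_matrix :: real ^ 'n ^ 'n) $ i"
  \<comment> \<open>\<open>W\<close> is the variance with each square expanded around
    \<open>xstar \<alpha>\<close>. It is defined for all \<open>\<omega>\<close>, whereas
    \<open>V\<close> is prescribed only on \<open>space M\<close>, which suffices for
    integrals.\<close>
  define W where "W \<omega> = (\<Sum>i\<in>UNIV. (?p i \<bullet> xstar \<alpha>)\<^sup>2 +
    2 * (?p i \<bullet> xstar \<alpha>) * (?p i \<bullet> z \<omega>) + (?p i \<bullet> z \<omega>)\<^sup>2) / (real CARD('n) - 1)" for \<omega>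
  have V: "V \<omega> = W \<omega>" if "\<omega> \<in> space M" for \<omega>
    using that assms(5,6)
    by (simp add: W_def component_variance_centering_matrix inner_add_right power2_sum add_ac)
  have "integrable M W"
    unfolding W_def by (intro Bochner_Integration.integrable_divide
        Bochner_Integration.integrable_sum Bochner_Integration.integrable_add integrable_mult_right
        integrable_const moments)
  moreover have "(\<integral>\<omega>. W \<omega> \<partial>M) =
      (\<Sum>i\<in>UNIV. (?p i \<bullet> xstar \<alpha>)\<^sup>2 + ?p i \<bullet> (C \<alpha> *v ?p i)) / (real CARD('n) - 1)"
    \<comment> \<open>The constants keep their value since \<open>M\<close> has total mass 1, and
      the cross terms vanish since \<open>z\<close> has mean zero.\<close>
    unfolding W_def by (simp add: moments prob_space)
  moreover have "integrable M V \<longleftrightarrow> integrable M W" "(\<integral>\<omega>. V \<omega> \<partial>M) = (\<integral>\<omega>. W \<omega> \<partial>M)"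
    by (rule Bochner_Integration.integrable_cong Bochner_Integration.integral_cong; simp add: V)+
  \<comment> \<open>Splitting the sum separates the variance of \<open>xstar \<alpha>\<close> from
    the noise term, which is the trace.\<close>
  ultimately show ?thesis
    by (simp add: component_variance_centering_matrix sum.distrib trace_centering_matrix
        add_divide_distrib)
qed

end
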